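(* Let $p_\theta(s,a,s')$ be a probability distribution on $\mathcal S\times\mathcal A\times\mathcal S$, let $p_\theta(s)$ be its marginal distribution of $s$, and let $p_\theta(a\mid s)$ and $p_\theta(s'\mid s,a)$ be its conditional distributions given $s$ and given $(s,a)$, respectively. Let $\pi$ be a policy, let $d^\pi$ be its discounted stationary state distribution, let $T(s'\mid s,a)$ be the transition function of the MDP, and let $q_\pi(s,a,s')=d^\pi(s)\,\pi(a\mid s)\,T(s'\mid s,a)$. Suppose that the energy function $\mathcal E$ has the form $$\mathcal E(s,a,s')=\mathcal E_1(s)+\mathcal E_2(a\mid s)+\mathcal E_3(s'\mid s,a),$$ where $$e^{\mathcal E_1(s)}\propto\frac{p_\theta(s)}{d^\pi(s)},\qquad e^{\mathcal E_2(a\mid s)}\propto\frac{p_\theta(a\mid s)}{\pi(a\mid s)},\qquad e^{\mathcal E_3(s'\mid s,a)}\propto\frac{p_\theta(s'\mid s,a)}{T(s'\mid s,a)}.$$ Then $$q_\pi(s,a,s')\propto p_\theta(s,a,s')\,e^{-\mathcal E(s,a,s')}.$$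
   Context: The MDP has state space $\mathcal S$, action space $\mathcal A$, transition function $T(\cdot\mid s,a)$ (a probability distribution on $\mathcal S$ for each $(s,a)$), discount factor $\gamma\in[0,1)$ and initial state distribution $\rho_0$. A policy $\pi$ assigns to each state $s$ a probability distribution $\pi(\cdot\mid s)$ on $\mathcal A$. The discounted stationary state distribution is $d^\pi(s)=\sum_{t\ge 0}\gamma^t\Pr(s_t=s;\pi)$ (not normalized), where $s_0\sim\rho_0$, $a_t\sim\pi(\cdot\mid s_t)$, $s_{t+1}\sim T(\cdot\mid s_t,a_t)$. The function $q_\pi$ represents the online data distribution of the policy $\pi$. All distributions are identified with their densities (or mass functions), which are taken to be positive so that the displayed ratios are defined and the energies $\mathcal E_1,\mathcal E_2,\mathcal E_3$ are real-valued. The relation $f\propto g$ means $f=k\,g$ for some constant $k>0$ that does not depend on any of the variables $s,a,s'$. *)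

theory Defs
  imports "HOL-Probability.Probability"
begin

(* Distributions are given by real-valued densities with respect to sigma-finite reference
   measures \<mu>S on the state space and \<mu>A on the action space.  Taking
   \<mu>S = count_space of a countable set gives mass functions; taking \<mu>S = lborel gives
   Lebesgue densities. *)

definition prob_density :: "'x measure \<Rightarrow> ('x \<Rightarrow> real) \<Rightarrow> bool" where
  "prob_density M f \<longleftrightarrow>
     f \<in> borel_measurable M \<and> (\<forall>x\<in>space M. 0 \<le> f x) \<and>
     prob_space (density M (\<lambda>x. ennreal (f x)))"

definition kernel_density :: "'x measure \<Rightarrow> 'y measure \<Rightarrow> ('x \<Rightarrow> 'y \<Rightarrow> real) \<Rightarrow> bool" where
  "kernel_density M N f \<longleftrightarrow>
     (\<lambda>(x, y). f x y) \<in> borel_measurable (M \<Otimes>\<^sub>M N) \<and> (\<forall>x\<in>space M. prob_density N (f x))"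

definition prop_on :: "'x set \<Rightarrow> ('x \<Rightarrow> real) \<Rightarrow> ('x \<Rightarrow> real) \<Rightarrow> bool" where
  "prop_on X f g \<longleftrightarrow> (\<exists>k>0. \<forall>x\<in>X. f x = k * g x)"

locale mdp = S: sigma_finite_measure \<mu>S + A: sigma_finite_measure \<mu>A
  for \<mu>S :: "'s measure" and \<mu>A :: "'a measure" +
  fixes T :: "'s \<times> 'a \<Rightarrow> 's \<Rightarrow> real" and \<gamma> :: real and \<rho>0 :: "'s \<Rightarrow> real"
  assumes transition: "kernel_density (\<mu>S \<Otimes>\<^sub>M \<mu>A) \<mu>S T"
    and initial: "prob_density \<mu>S \<rho>0"
    and discount: "0 \<le> \<gamma>" "\<gamma> < 1"

abbreviation policy :: "'s measure \<Rightarrow> 'a measure \<Rightarrow> ('s \<Rightarrow> 'a \<Rightarrow> real) \<Rightarrow> bool" where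
  "policy \<mu>S \<mu>A \<pi> \<equiv> kernel_density \<mu>S \<mu>A \<pi>"

(* The density of s_t.  Lemma state_law_eq_density below identifies it with the law of s_t
   obtained by sampling a trajectory. *)
primrec state_density :: "'s measure \<Rightarrow> 'a measure \<Rightarrow> ('s \<times> 'a \<Rightarrow> 's \<Rightarrow> real) \<Rightarrow> ('s \<Rightarrow> real) \<Rightarrow>
    ('s \<Rightarrow> 'a \<Rightarrow> real) \<Rightarrow> nat \<Rightarrow> 's \<Rightarrow> ennreal" where
  "state_density \<mu>S \<mu>A T \<rho>0 \<pi> 0 = (\<lambda>s'. ennreal (\<rho>0 s'))"
| "state_density \<mu>S \<mu>A T \<rho>0 \<pi> (Suc t) =
     (\<lambda>s'. \<integral>\<^sup>+ s. state_density \<mu>S \<mu>A T \<rho>0 \<pi> t s *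
             (\<integral>\<^sup>+ a. ennreal (\<pi> s a) * ennreal (T (s, a) s') \<partial>\<mu>A) \<partial>\<mu>S)"

(* Not normalised.  For continuous states the value at a single point may be infinite. *)
definition discounted_density :: "'s measure \<Rightarrow> 'a measure \<Rightarrow> ('s \<times> 'a \<Rightarrow> 's \<Rightarrow> real) \<Rightarrow> real \<Rightarrow>
    ('s \<Rightarrow> real) \<Rightarrow> ('s \<Rightarrow> 'a \<Rightarrow> real) \<Rightarrow> 's \<Rightarrow> ennreal" where
  "discounted_density \<mu>S \<mu>A T \<gamma> \<rho>0 \<pi> s =
     (\<Sum>t. ennreal (\<gamma> ^ t) * state_density \<mu>S \<mu>A T \<rho>0 \<pi> t s)"

definition marginal_sa :: "'s measure \<Rightarrow> ('s \<times> 'a \<times> 's \<Rightarrow> real) \<Rightarrow> 's \<Rightarrow> 'a \<Rightarrow> ennreal" where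
  "marginal_sa \<mu>S p s a = (\<integral>\<^sup>+ s'. ennreal (p (s, a, s')) \<partial>\<mu>S)"

definition marginal_s :: "'s measure \<Rightarrow> 'a measure \<Rightarrow> ('s \<times> 'a \<times> 's \<Rightarrow> real) \<Rightarrow> 's \<Rightarrow> ennreal" where
  "marginal_s \<mu>S \<mu>A p s = (\<integral>\<^sup>+ z. ennreal (p (s, z)) \<partial>(\<mu>A \<Otimes>\<^sub>M \<mu>S))"

definition cond_a :: "'s measure \<Rightarrow> 'a measure \<Rightarrow> ('s \<times> 'a \<times> 's \<Rightarrow> real) \<Rightarrow> 's \<Rightarrow> 'a \<Rightarrow> real" where
  "cond_a \<mu>S \<mu>A p s a = enn2real (marginal_sa \<mu>S p s a) / enn2real (marginal_s \<mu>S \<mu>A p s)"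

definition cond_s' :: "'s measure \<Rightarrow> ('s \<times> 'a \<times> 's \<Rightarrow> real) \<Rightarrow> 's \<Rightarrow> 'a \<Rightarrow> 's \<Rightarrow> real" where
  "cond_s' \<mu>S p s a s' = p (s, a, s') / enn2real (marginal_sa \<mu>S p s a)"

definition online_density :: "'s measure \<Rightarrow> 'a measure \<Rightarrow> ('s \<times> 'a \<Rightarrow> 's \<Rightarrow> real) \<Rightarrow> real \<Rightarrow>
    ('s \<Rightarrow> real) \<Rightarrow> ('s \<Rightarrow> 'a \<Rightarrow> real) \<Rightarrow> 's \<times> 'a \<times> 's \<Rightarrow> real" where
  "online_density \<mu>S \<mu>A T \<gamma> \<rho>0 \<pi> =
     (\<lambda>(s, a, s'). enn2real (discounted_density \<mu>S \<mu>A T \<gamma> \<rho>0 \<pi> s) * \<pi> s a * T (s, a) s')"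

primrec state_law :: "'s measure \<Rightarrow> 'a measure \<Rightarrow> ('s \<times> 'a \<Rightarrow> 's \<Rightarrow> real) \<Rightarrow> ('s \<Rightarrow> real) \<Rightarrow>
    ('s \<Rightarrow> 'a \<Rightarrow> real) \<Rightarrow> nat \<Rightarrow> 's measure" where
  "state_law \<mu>S \<mu>A T \<rho>0 \<pi> 0 = density \<mu>S (\<lambda>s. ennreal (\<rho>0 s))"
| "state_law \<mu>S \<mu>A T \<rho>0 \<pi> (Suc t) =
     state_law \<mu>S \<mu>A T \<rho>0 \<pi> t \<bind>
       (\<lambda>s. density \<mu>A (\<lambda>a. ennreal (\<pi> s a)) \<bind>
       (\<lambda>a. density \<mu>S (\<lambda>s'. ennreal (T (s, a) s'))))"

lemma measurable_density_kernel:
  assumes N: "sigma_finite_measure N"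
    and f[measurable]: "(\<lambda>(x, y). f x y) \<in> borel_measurable (M \<Otimes>\<^sub>M N)"
    and p: "\<And>x. x \<in> space M \<Longrightarrow> prob_space (density N (f x))"
  shows "(\<lambda>x. density N (f x)) \<in> measurable M (subprob_algebra N)"
proof (rule measurable_subprob_algebra)
  interpret sigma_finite_measure N by fact
  fix B assume B[measurable]: "B \<in> sets N"
  have "(\<lambda>x. \<integral>\<^sup>+ y. f x y * indicator B y \<partial>N) \<in> borel_measurable M"
    by measurable
  moreover have "emeasure (density N (f x)) B = (\<integral>\<^sup>+ y. f x y * indicator B y \<partial>N)"
    if "x \<in> space M" for x
    using that by (intro emeasure_density) auto
  ultimately show "(\<lambda>x. emeasure (density N (f x)) B) \<in> borel_measurable M"
    by (subst measurable_cong) auto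
qed (auto intro: p prob_space_imp_subprob_space)

lemma bind_density_kernel:
  assumes M: "sigma_finite_measure M" and N: "sigma_finite_measure N"
    and g[measurable]: "g \<in> borel_measurable M" and ne: "space M \<noteq> {}"
    and f[measurable]: "(\<lambda>(x, y). f x y) \<in> borel_measurable (M \<Otimes>\<^sub>M N)"
    and p: "\<And>x. x \<in> space M \<Longrightarrow> prob_space (density N (f x))"
  shows "density M g \<bind> (\<lambda>x. density N (f x)) = density N (\<lambda>y. \<integral>\<^sup>+ x. g x * f x y \<partial>M)"
    (is "?L = ?R")
proof -
  interpret M: sigma_finite_measure M by fact
  interpret N: sigma_finite_measure N by fact
  interpret P: pair_sigma_finite M N ..
  have K: "(\<lambda>x. density N (f x)) \<in> measurable (density M g) (subprob_algebra N)"
    using measurable_density_kernel[OF N f p] by simp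
  have setsL: "sets ?L = sets N"
    using ne by (subst sets_bind[where N = N]) auto
  show ?thesis
  proof (rule measure_eqI)
    show "sets ?L = sets ?R" using setsL by simp
    fix B assume "B \<in> sets ?L"
    then have B[measurable]: "B \<in> sets N" using setsL by simp
    have "emeasure ?L B = (\<integral>\<^sup>+ x. emeasure (density N (f x)) B \<partial>density M g)"
      using ne by (intro emeasure_bind[OF _ K B]) simp
    also have "\<dots> = (\<integral>\<^sup>+ x. g x * emeasure (density N (f x)) B \<partial>M)"
      using K by (intro nn_integral_density measurable_emeasure_kernel[where N = N]) (auto intro: B)
    also have "\<dots> = (\<integral>\<^sup>+ x. (\<integral>\<^sup>+ y. g x * f x y * indicator B y \<partial>N) \<partial>M)"
    proof (rule nn_integral_cong)
      fix x assume [measurable]: "x \<in> space M"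
      show "g x * emeasure (density N (f x)) B = (\<integral>\<^sup>+ y. g x * f x y * indicator B y \<partial>N)"
        by (simp add: emeasure_density nn_integral_cmult[symmetric] mult.assoc)
    qed
    also have "\<dots> = (\<integral>\<^sup>+ y. (\<integral>\<^sup>+ x. g x * f x y * indicator B y \<partial>M) \<partial>N)"
      by (intro P.Fubini'[symmetric]) measurable
    also have "\<dots> = (\<integral>\<^sup>+ y. (\<integral>\<^sup>+ x. g x * f x y \<partial>M) * indicator B y \<partial>N)"
      by (intro nn_integral_cong nn_integral_multc) measurable
    also have "\<dots> = emeasure ?R B"
      by (subst emeasure_density) auto
    finally show "emeasure ?L B = emeasure ?R B" .
  qed
qed

lemma (in mdp) state_law_eq_density:
  assumes \<pi>: "policy \<mu>S \<mu>A \<pi>"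
  shows "state_density \<mu>S \<mu>A T \<rho>0 \<pi> t \<in> borel_measurable \<mu>S"
    and "state_law \<mu>S \<mu>A T \<rho>0 \<pi> t = density \<mu>S (state_density \<mu>S \<mu>A T \<rho>0 \<pi> t)"
proof -
  define k where "k s s' = (\<integral>\<^sup>+ a. ennreal (\<pi> s a) * ennreal (T (s, a) s') \<partial>\<mu>A)" for s s'
  have T[measurable]: "(\<lambda>(x, y). T x y) \<in> borel_measurable ((\<mu>S \<Otimes>\<^sub>M \<mu>A) \<Otimes>\<^sub>M \<mu>S)"
    and Tp: "\<And>x. x \<in> space (\<mu>S \<Otimes>\<^sub>M \<mu>A) \<Longrightarrow> prob_space (density \<mu>S (\<lambda>s'. ennreal (T x s')))"
    using transition by (auto simp: kernel_density_def prob_density_def)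
  have P[measurable]: "(\<lambda>(s, a). \<pi> s a) \<in> borel_measurable (\<mu>S \<Otimes>\<^sub>M \<mu>A)"
    and Pp: "\<And>s. s \<in> space \<mu>S \<Longrightarrow> prob_space (density \<mu>A (\<lambda>a. ennreal (\<pi> s a)))"
    using \<pi> by (auto simp: kernel_density_def prob_density_def)
  have R[measurable]: "\<rho>0 \<in> borel_measurable \<mu>S"
    and Rp: "prob_space (density \<mu>S (\<lambda>s. ennreal (\<rho>0 s)))"
    using initial by (auto simp: prob_density_def)
  have neS: "space \<mu>S \<noteq> {}" using prob_space.not_empty[OF Rp] by simp
  have k[measurable]: "(\<lambda>(s, s'). k s s') \<in> borel_measurable (\<mu>S \<Otimes>\<^sub>M \<mu>S)"
  proof -
    have "(\<lambda>((s, s'), a). T (s, a) s') \<in> borel_measurable ((\<mu>S \<Otimes>\<^sub>M \<mu>S) \<Otimes>\<^sub>M \<mu>A)"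
      using measurable_compose[OF _ T, of "\<lambda>((s, s'), a). ((s, a), s')"]
      by (simp add: case_prod_unfold)
    moreover have "(\<lambda>((s, s'), a). \<pi> s a) \<in> borel_measurable ((\<mu>S \<Otimes>\<^sub>M \<mu>S) \<Otimes>\<^sub>M \<mu>A)"
      using measurable_compose[OF _ P, of "\<lambda>((s, s'), a). (s, a)"]
      by (simp add: case_prod_unfold)
    ultimately have "(\<lambda>(x, a). ennreal (\<pi> (fst x) a) * ennreal (T (fst x, a) (snd x)))
        \<in> borel_measurable ((\<mu>S \<Otimes>\<^sub>M \<mu>S) \<Otimes>\<^sub>M \<mu>A)"
      by (simp add: case_prod_unfold)
    from A.borel_measurable_nn_integral[OF this]
    show ?thesis by (simp add: k_def case_prod_unfold)
  qed
  have step: "density \<mu>A (\<lambda>a. ennreal (\<pi> s a)) \<bind> (\<lambda>a. density \<mu>S (\<lambda>s'. ennreal (T (s, a) s')))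
      = density \<mu>S (k s)" and kp: "prob_space (density \<mu>S (k s))" if s: "s \<in> space \<mu>S" for s
  proof -
    note [measurable] = s
    have [measurable]: "(\<lambda>a. ennreal (\<pi> s a)) \<in> borel_measurable \<mu>A"
      using measurable_compose[OF measurable_Pair1'[OF s] P] by simp
    have "(\<lambda>x. ((s, fst x), snd x)) \<in> measurable (\<mu>A \<Otimes>\<^sub>M \<mu>S) ((\<mu>S \<Otimes>\<^sub>M \<mu>A) \<Otimes>\<^sub>M \<mu>S)"
      using s by simp
    from measurable_compose[OF this T]
    have m: "(\<lambda>(a, s'). ennreal (T (s, a) s')) \<in> borel_measurable (\<mu>A \<Otimes>\<^sub>M \<mu>S)"
      by (simp add: case_prod_unfold)
    have q: "prob_space (density \<mu>S (\<lambda>s'. ennreal (T (s, a) s')))" if "a \<in> space \<mu>A" for a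
      using that s by (intro Tp) (simp add: space_pair_measure)
    interpret P': prob_space "density \<mu>A (\<lambda>a. ennreal (\<pi> s a))" by (rule Pp[OF s])
    show eq: "density \<mu>A (\<lambda>a. ennreal (\<pi> s a)) \<bind> (\<lambda>a. density \<mu>S (\<lambda>s'. ennreal (T (s, a) s')))
      = density \<mu>S (k s)"
      using P'.not_empty unfolding k_def[abs_def]
      by (intro bind_density_kernel A.sigma_finite_measure_axioms S.sigma_finite_measure_axioms m q)
         auto
    have "(\<lambda>a. density \<mu>S (\<lambda>s'. ennreal (T (s, a) s')))
        \<in> measurable (density \<mu>A (\<lambda>a. ennreal (\<pi> s a))) (subprob_algebra \<mu>S)"
      using measurable_density_kernel[OF S.sigma_finite_measure_axioms m q] by simp
    from P'.prob_space_bind[OF AE_I2 this] show "prob_space (density \<mu>S (k s))"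
      unfolding eq using q by simp
  qed
  have "state_density \<mu>S \<mu>A T \<rho>0 \<pi> t \<in> borel_measurable \<mu>S \<and>
        state_law \<mu>S \<mu>A T \<rho>0 \<pi> t = density \<mu>S (state_density \<mu>S \<mu>A T \<rho>0 \<pi> t)"
  proof (induction t)
    case (Suc t)
    then have m[measurable]: "state_density \<mu>S \<mu>A T \<rho>0 \<pi> t \<in> borel_measurable \<mu>S" by simp
    have d: "state_density \<mu>S \<mu>A T \<rho>0 \<pi> (Suc t) =
        (\<lambda>s'. \<integral>\<^sup>+ s. state_density \<mu>S \<mu>A T \<rho>0 \<pi> t s * k s s' \<partial>\<mu>S)"
      by (simp add: k_def)
    have "state_law \<mu>S \<mu>A T \<rho>0 \<pi> (Suc t) =
        density \<mu>S (state_density \<mu>S \<mu>A T \<rho>0 \<pi> t) \<bind> (\<lambda>s. density \<mu>S (k s))"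
      using Suc by (auto intro!: bind_cong step)
    also have "\<dots> = density \<mu>S (state_density \<mu>S \<mu>A T \<rho>0 \<pi> (Suc t))"
      unfolding d
      by (intro bind_density_kernel S.sigma_finite_measure_axioms m neS k kp)
    finally have "state_law \<mu>S \<mu>A T \<rho>0 \<pi> (Suc t) = density \<mu>S (state_density \<mu>S \<mu>A T \<rho>0 \<pi> (Suc t))" .
    moreover have "(\<lambda>(s', s). state_density \<mu>S \<mu>A T \<rho>0 \<pi> t s * k s s') \<in> borel_measurable (\<mu>S \<Otimes>\<^sub>M \<mu>S)"
      using measurable_compose[OF measurable_pair_swap' k]
      by (auto simp: case_prod_unfold intro!: borel_measurable_times_ennreal)
    from S.borel_measurable_nn_integral[OF this]
    have "state_density \<mu>S \<mu>A T \<rho>0 \<pi> (Suc t) \<in> borel_measurable \<mu>S"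
      unfolding d .
    ultimately show ?case by blast
  qed simp
  then show "state_density \<mu>S \<mu>A T \<rho>0 \<pi> t \<in> borel_measurable \<mu>S"
    and "state_law \<mu>S \<mu>A T \<rho>0 \<pi> t = density \<mu>S (state_density \<mu>S \<mu>A T \<rho>0 \<pi> t)" by auto
qed

end

theory Submission
  imports Defs
begin

text \<open>The product of the three ratios telescopes to \<open>p / (d \<pi> T)\<close>. Dividing by the marginals
  is legitimate because each ratio is a positive multiple of an exponential, so no denominator or
  numerator vanishes.\<close>

theorem theorem3p1:
  fixes \<mu>S :: "'s measure" and \<mu>A :: "'a measure"
    and T :: "'s \<times> 'a \<Rightarrow> 's \<Rightarrow> real" and \<gamma> :: real and \<rho>0 :: "'s \<Rightarrow> real"
    and \<pi> :: "'s \<Rightarrow> 'a \<Rightarrow> real" and p :: "'s \<times> 'a \<times> 's \<Rightarrow> real"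
    and E :: "'s \<times> 'a \<times> 's \<Rightarrow> real"
    and E1 :: "'s \<Rightarrow> real" and E2 :: "'s \<Rightarrow> 'a \<Rightarrow> real" and E3 :: "'s \<Rightarrow> 'a \<Rightarrow> 's \<Rightarrow> real"
  assumes mdp: "mdp \<mu>S \<mu>A T \<gamma> \<rho>0"
    and policy: "policy \<mu>S \<mu>A \<pi>"
    and p: "prob_density (\<mu>S \<Otimes>\<^sub>M \<mu>A \<Otimes>\<^sub>M \<mu>S) p"
    and T_pos: "\<And>s a s'. s \<in> space \<mu>S \<Longrightarrow> a \<in> space \<mu>A \<Longrightarrow> s' \<in> space \<mu>S \<Longrightarrow> 0 < T (s, a) s'"
    and \<pi>_pos: "\<And>s a. s \<in> space \<mu>S \<Longrightarrow> a \<in> space \<mu>A \<Longrightarrow> 0 < \<pi> s a"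
    and p_pos: "\<And>s a s'. s \<in> space \<mu>S \<Longrightarrow> a \<in> space \<mu>A \<Longrightarrow> s' \<in> space \<mu>S \<Longrightarrow> 0 < p (s, a, s')"
    and d_pos: "\<And>s. s \<in> space \<mu>S \<Longrightarrow> 0 < discounted_density \<mu>S \<mu>A T \<gamma> \<rho>0 \<pi> s"
    and d_finite: "\<And>s. s \<in> space \<mu>S \<Longrightarrow> discounted_density \<mu>S \<mu>A T \<gamma> \<rho>0 \<pi> s < \<infinity>"
    and ps_finite: "\<And>s. s \<in> space \<mu>S \<Longrightarrow> marginal_s \<mu>S \<mu>A p s < \<infinity>"
    and psa_finite: "\<And>s a. s \<in> space \<mu>S \<Longrightarrow> a \<in> space \<mu>A \<Longrightarrow> marginal_sa \<mu>S p s a < \<infinity>"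
    and E: "\<And>s a s'. s \<in> space \<mu>S \<Longrightarrow> a \<in> space \<mu>A \<Longrightarrow> s' \<in> space \<mu>S \<Longrightarrow>
              E (s, a, s') = E1 s + E2 s a + E3 s a s'"
    and E1: "prop_on (space \<mu>S)
               (\<lambda>s. exp (E1 s))
               (\<lambda>s. enn2real (marginal_s \<mu>S \<mu>A p s) /
                    enn2real (discounted_density \<mu>S \<mu>A T \<gamma> \<rho>0 \<pi> s))"
    and E2: "prop_on (space \<mu>S \<times> space \<mu>A)
               (\<lambda>(s, a). exp (E2 s a))
               (\<lambda>(s, a). cond_a \<mu>S \<mu>A p s a / \<pi> s a)"
    and E3: "prop_on (space \<mu>S \<times> space \<mu>A \<times> space \<mu>S)
               (\<lambda>(s, a, s'). exp (E3 s a s'))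
               (\<lambda>(s, a, s'). cond_s' \<mu>S p s a s' / T (s, a) s')"
  shows "prop_on (space \<mu>S \<times> space \<mu>A \<times> space \<mu>S)
           (online_density \<mu>S \<mu>A T \<gamma> \<rho>0 \<pi>)
           (\<lambda>(s, a, s'). p (s, a, s') * exp (- E (s, a, s')))"
proof -
  \<comment> \<open>The three constants are fixed before any point \<open>(s, a, s')\<close> is
    chosen, so their product can serve as one constant for the whole space.\<close>
  obtain k1 where k1: "k1 > 0" and e1: "\<And>s. s \<in> space \<mu>S \<Longrightarrow> exp (E1 s) =
      k1 * (enn2real (marginal_s \<mu>S \<mu>A p s) / enn2real (discounted_density \<mu>S \<mu>A T \<gamma> \<rho>0 \<pi> s))"
    using E1 by (auto simp: prop_on_def)
  obtain k2 where k2: "k2 > 0" and e2: "\<And>s a. s \<in> space \<mu>S \<Longrightarrow> a \<in> space \<mu>A \<Longrightarrow> exp (E2 s a) =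
      k2 * (cond_a \<mu>S \<mu>A p s a / \<pi> s a)"
    using E2 by (auto simp: prop_on_def)
  obtain k3 where k3: "k3 > 0" and e3: "\<And>s a s'. s \<in> space \<mu>S \<Longrightarrow> a \<in> space \<mu>A \<Longrightarrow>
      s' \<in> space \<mu>S \<Longrightarrow> exp (E3 s a s') = k3 * (cond_s' \<mu>S p s a s' / T (s, a) s')"
    using E3 by (auto simp: prop_on_def)
  have "online_density \<mu>S \<mu>A T \<gamma> \<rho>0 \<pi> (s, a, s') = (k1 * k2 * k3) * (p (s, a, s') * exp (- E (s, a, s')))"
    if s: "s \<in> space \<mu>S" and a: "a \<in> space \<mu>A" and s': "s' \<in> space \<mu>S" for s a s'
  proof -
    \<comment> \<open>Naming the three real values makes them atoms for the field arithmetic below: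
      \<open>m\<close> occurs in the first two ratios and \<open>n\<close> in the last two, once as
      numerator and once as denominator.\<close>
    define d where "d = enn2real (discounted_density \<mu>S \<mu>A T \<gamma> \<rho>0 \<pi> s)"
    define m where "m = enn2real (marginal_s \<mu>S \<mu>A p s)"
    define n where "n = enn2real (marginal_sa \<mu>S p s a)"
    have x1: "exp (E1 s) = k1 * (m / d)"
      using e1[OF s] by (simp add: m_def d_def)
    have x2: "exp (E2 s a) = k2 * (n / m / \<pi> s a)"
      using e2[OF s a] by (simp add: cond_a_def m_def n_def)
    have x3: "exp (E3 s a s') = k3 * (p (s, a, s') / n / T (s, a) s')"
      using e3[OF s a s'] by (simp add: cond_s'_def n_def)
    \<comment> \<open>Division by zero yields 0 in HOL, so a zero in either the numerator or the
      denominator would make the right-hand side of \<open>x1\<close>, \<open>x2\<close> or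
      \<open>x3\<close> vanish, while an exponential never does.\<close>
    have nz: "m \<noteq> 0" "d \<noteq> 0" "n \<noteq> 0" "\<pi> s a \<noteq> 0" "T (s, a) s' \<noteq> 0"
      using x1 x2 x3 by (metis exp_not_eq_zero div_0 div_by_0 mult_zero_right)+
    have "exp (E (s, a, s')) = exp (E1 s) * exp (E2 s a) * exp (E3 s a s')"
      by (simp add: E[OF s a s'] exp_add)
    \<comment> \<open>Here \<open>m\<close> cancels between \<open>x1\<close> and \<open>x2\<close>,
      and \<open>n\<close> between \<open>x2\<close> and \<open>x3\<close>.\<close>
    also have "\<dots> = k1 * k2 * k3 * p (s, a, s') / (d * \<pi> s a * T (s, a) s')"
      unfolding x1 x2 x3 using nz by (simp add: field_simps)
    \<comment> \<open>Clearing denominators leaves the online density at the point,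
      \<open>d * \<pi> s a * T (s, a) s'\<close>, times the exponential of the energy. Since
      \<open>exp (- x)\<close> is the inverse of \<open>exp x\<close>, moving that factor across
      gives the claim.\<close>
    finally have "d * \<pi> s a * T (s, a) s' * exp (E (s, a, s')) = k1 * k2 * k3 * p (s, a, s')"
      using nz by (simp add: field_simps)
    then show ?thesis
      by (simp add: online_density_def d_def exp_minus field_simps)
  qed
  moreover have "0 < k1 * k2 * k3"
    using k1 k2 k3 by simp
  ultimately show ?thesis
    unfolding prop_on_def by (intro exI[of _ "k1 * k2 * k3"]) auto
qed

end
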